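(* Let $n\in\mathbb Z$ and write $f_n=\mathfrak P_\varphi(\lambda^n\varphi_\lambda)=\sum_{i\ge1}f^{(i)}\lambda^i$, the coefficients $f^{(i)}$ being regarded as functions on the covering $\bar\tau_*$ via $\varphi^{(1)}=-y$, $\varphi^{(2)}=-x$, $\varphi^{(3)}=-z-\tfrac12y^2$. Put $$Z=(z_y+y)f^{(1)}+z_xf^{(2)}-f^{(3)},\qquad \Phi^{(k)}=f^{(k)}+f^{(2)}\varphi^{(k)}_x+f^{(1)}\varphi^{(k)}_y\quad(k\ge4),$$ and let $\mathcal S=\sum_X\tilde D_X(Z)\,\partial/\partial z_X+\sum_{k\ge4}\Phi^{(k)}\,\partial/\partial\varphi^{(k)}$, the first sum running over all internal coordinates $z_X$ ($X=x^a$ or $X=x^ay$, $a\ge0$) and $\tilde D_X=\tilde D_x^{a}\tilde D_y^{b}$ for $X=x^ay^b$. Then $\mathcal S$ is a (nonlocal) symmetry of the Gibbons–Tsarev equation in the covering $\bar\tau_*$, i.e. $[\mathcal S,\tilde D_x]=[\mathcal S,\tilde D_y]=0$.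
   Context: The Gibbons–Tsarev equation $\mathcal E$ is $z_{yy}+z_xz_{xy}-z_yz_{xx}+1=0$ for $z(x,y)$, taken with all differential consequences; internal coordinates are $x,y$ and $z_X=\partial^{a+b}z/\partial x^a\partial y^b$ for $X=x^ay^b$ with $b\in\{0,1\}$ (derivatives with $b\ge2$ are expressed through these using the equation); $D_x,D_y$ are the total derivatives. Put $\varphi^{(-1)}=1$, $\varphi^{(0)}=0$, $\varphi^{(1)}=-y$, $\varphi^{(2)}=-x$, $\varphi^{(3)}=-z-\tfrac12y^2$, let $\varphi^{(k)}$, $k\ge4$, be new coordinates, and let $\varphi(\lambda)=1/\lambda+\sum_{k\ge1}\varphi^{(k)}\lambda^k$ (formal Laurent series in a parameter $\lambda$), $\varphi_\lambda=d\varphi/d\lambda$. The covering $\bar\tau_*$ is the space with coordinates $x,y,z_X,\varphi^{(k)}$ ($k\ge4$) and commuting total derivatives $\tilde D_x=D_x+\sum_{k\ge4}\varphi^{(k)}_x\partial/\partial\varphi^{(k)}$, $\tilde D_y=D_y+\sum_{k\ge4}\varphi^{(k)}_y\partial/\partial\varphi^{(k)}$, where the functions $\varphi^{(k)}_x,\varphi^{(k)}_y$ (polynomials in $x,y,z,z_x,z_y,\varphi^{(4)},\dots,\varphi^{(k-1)}$) are uniquely determined by requiring that, with $\varphi_x=\sum_{k\ge1}\tilde D_x(\varphi^{(k)})\lambda^k$ and $\varphi_y=\sum_{k\ge1}\tilde D_y(\varphi^{(k)})\lambda^k$, the identities $(\varphi^2-z_x\varphi-z_y)\varphi_x=-1$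 and $(\varphi^2-z_x\varphi-z_y)\varphi_y=-(\varphi-z_x)$ hold coefficientwise in $\lambda$. Notation $\mathfrak P_\varphi$: let $w=1/\varphi(\lambda)=\lambda+O(\lambda^3)$; any Laurent series $F$ in $\lambda$ with finitely many negative powers can be written uniquely as $F=\sum_{k\le m}c_k\varphi(\lambda)^k$ with $c_k$ independent of $\lambda$; put $P_\varphi F=\sum_{k=0}^mc_k\varphi^k$ and $\mathfrak P_\varphi F=F-P_\varphi F$, a power series in $\lambda$ without constant term whose coefficients are polynomials in the $\varphi^{(j)}$. *)

theory Defs
  imports "HOL-Library.Poly_Mapping" "HOL-Computational_Algebra.Formal_Laurent_Series"
begin

text \<open>Coordinates of the covering space: x, y, the internal coordinates
  z_X with X = x^a y^b (b in {0,1}; Zc a False = z_{x^a}, Zc a True = z_{x^a y}),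
  and the nonlocal coordinates phi^(k), k >= 4 (Phi j stands for phi^(j+4)).\<close>

datatype coord = Xc | Yc | Zc nat bool | Phi nat

text \<open>All functions occurring in the statement are polynomials over the rationals
  in these coordinates.\<close>

type_synonym fn = "(coord \<Rightarrow>\<^sub>0 nat) \<Rightarrow>\<^sub>0 rat"

definition var :: "coord \<Rightarrow> fn" where
  "var v = Poly_Mapping.single (Poly_Mapping.single v 1) 1"

definition cst :: "rat \<Rightarrow> fn" where
  "cst c = Poly_Mapping.single 0 c"

definition vars :: "fn \<Rightarrow> coord set" where
  "vars p = (\<Union>m\<in>Poly_Mapping.keys p. Poly_Mapping.keys m)"

definition pdiff :: "coord \<Rightarrow> fn \<Rightarrow> fn" where
  "pdiff v p = (\<Sum>m\<in>Poly_Mapping.keys p.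
      Poly_Mapping.single (m - Poly_Mapping.single v 1)
        (of_nat (Poly_Mapping.lookup m v) * Poly_Mapping.lookup p m))"

text \<open>The vector field with components E (the coefficient of d/dv is E v) applied
  to a function p.  Only the finitely many coordinates occurring in p contribute.\<close>

definition vf :: "(coord \<Rightarrow> fn) \<Rightarrow> fn \<Rightarrow> fn" where
  "vf E p = (\<Sum>v\<in>vars p. E v * pdiff v p)"

definition phiv :: "nat \<Rightarrow> fn" where
  "phiv k = (if k = 1 then - var Yc
             else if k = 2 then - var Xc
             else if k = 3 then - var (Zc 0 False) - cst (1/2) * var Yc ^ 2
             else if k \<ge> 4 then var (Phi (k - 4))
             else 0)"

definition phiL :: "fn fls" where
  "phiL = Abs_fls (\<lambda>m. if m = -1 then 1 else if m \<ge> 1 then phiv (nat m) else 0)"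

definition zx :: fn where "zx = var (Zc 1 False)"
definition zy :: fn where "zy = var (Zc 0 True)"

text \<open>The series phi_x and phi_y, uniquely determined by
  (phi^2 - z_x phi - z_y) phi_x = -1 and (phi^2 - z_x phi - z_y) phi_y = -(phi - z_x).\<close>

definition phixL :: "fn fls" where
  "phixL = (THE s. (phiL ^ 2 - fls_const zx * phiL - fls_const zy) * s = - 1)"

definition phiyL :: "fn fls" where
  "phiyL = (THE s. (phiL ^ 2 - fls_const zx * phiL - fls_const zy) * s
                    = - (phiL - fls_const zx))"

definition phix :: "nat \<Rightarrow> fn" where "phix k = fls_nth phixL (int k)"
definition phiy :: "nat \<Rightarrow> fn" where "phiy k = fls_nth phiyL (int k)"

definition Dx_coef :: "coord \<Rightarrow> fn" where
  "Dx_coef v = (case v of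
      Xc \<Rightarrow> 1
    | Yc \<Rightarrow> 0
    | Zc a b \<Rightarrow> var (Zc (Suc a) b)
    | Phi j \<Rightarrow> phix (j + 4))"

definition Dx :: "fn \<Rightarrow> fn" where "Dx = vf Dx_coef"

text \<open>z_yy expressed through the equation: z_yy = z_y z_xx - z_x z_xy - 1.\<close>

definition zyy :: fn where
  "zyy = var (Zc 0 True) * var (Zc 2 False) - var (Zc 1 False) * var (Zc 1 True) - 1"

definition Dy_coef :: "coord \<Rightarrow> fn" where
  "Dy_coef v = (case v of
      Xc \<Rightarrow> 0
    | Yc \<Rightarrow> 1
    | Zc a False \<Rightarrow> var (Zc a True)
    | Zc a True \<Rightarrow> (Dx ^^ a) zyy
    | Phi j \<Rightarrow> phiy (j + 4))"

definition Dy :: "fn \<Rightarrow> fn" where "Dy = vf Dy_coef"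

text \<open>For a Laurent series F with finitely many negative powers, F = sum_{k<=m} c_k phi^k
  uniquely (c_k independent of lambda); P_phi F = sum_{k=0}^m c_k phi^k and
  frak P_phi F = F - P_phi F, which is the unique series G with only positive powers
  of lambda such that F - G is a polynomial in phi with lambda-independent coefficients.\<close>

definition fPphi :: "fn fls \<Rightarrow> fn fls" where
  "fPphi F = (THE G. (\<forall>m. m \<le> 0 \<longrightarrow> fls_nth G m = 0) \<and>
      (\<exists>c :: nat \<Rightarrow> fn. \<exists>N. F - G = (\<Sum>k\<le>N. fls_const (c k) * phiL ^ k)))"

definition fco :: "int \<Rightarrow> nat \<Rightarrow> fn" where
  "fco n i = fls_nth (fPphi (fls_X_intpow n * fls_deriv phiL)) (int i)"

definition Zgen :: "int \<Rightarrow> fn" where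
  "Zgen n = (zy + var Yc) * fco n 1 + zx * fco n 2 - fco n 3"

definition Phigen :: "int \<Rightarrow> nat \<Rightarrow> fn" where
  "Phigen n k = fco n k + fco n 2 * phix k + fco n 1 * phiy k"

definition S_coef :: "int \<Rightarrow> coord \<Rightarrow> fn" where
  "S_coef n v = (case v of
      Xc \<Rightarrow> 0
    | Yc \<Rightarrow> 0
    | Zc a b \<Rightarrow> (Dx ^^ a) ((Dy ^^ (if b then 1 else 0)) (Zgen n))
    | Phi j \<Rightarrow> Phigen n (j + 4))"

definition Ssym :: "int \<Rightarrow> fn \<Rightarrow> fn" where "Ssym n = vf (S_coef n)"

end

theory Submission
  imports Defs
begin

unbundle fps_syntax

text \<open>
  Let \<open>Q = \<phi>\<^sup>2 - z\<^sub>x \<phi> - z\<^sub>y\<close>, so that \<open>\<phi>\<^sub>x = - 1 / Q\<close> and \<open>\<phi>\<^sub>y = (\<phi> - z\<^sub>x) \<phi>\<^sub>x\<close>, and let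
  derivations of functions act on Laurent series coefficientwise.  The definitions of \<open>Z\<close> and
  \<open>\<Phi>\<close> amount to \<open>S \<phi> = f + f\<^sub>2 \<phi>\<^sub>x + f\<^sub>1 \<phi>\<^sub>y\<close>.  Put \<open>U = D\<^sub>x f + D\<^sub>x(f\<^sub>2) \<phi>\<^sub>x + D\<^sub>x(f\<^sub>1) \<phi>\<^sub>y\<close>, and let
  \<open>V\<close> be the same expression with \<open>D\<^sub>y\<close> acting on \<open>f\<close>, \<open>f\<^sub>1\<close>, \<open>f\<^sub>2\<close>.  Since \<open>f\<close> is
  \<open>\<lambda>\<^sup>n \<phi>\<^sub>\<lambda>\<close> minus a polynomial in \<open>\<phi>\<close>, the series \<open>Q\<^sup>2 U - (2 \<phi> - z\<^sub>x) f\<close> and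
  \<open>Q V - (\<phi> - z\<^sub>x) Q U + f\<close> are polynomials in \<open>\<phi>\<close> with \<open>\<lambda>\<close>-independent coefficients, and such a
  polynomial is determined by its coefficients at nonpositive powers of \<open>\<lambda>\<close>.  Comparing these
  gives \<open>[S, D\<^sub>x] = 0\<close> and \<open>[S, D\<^sub>y] \<phi> = 0\<close>.  Finally \<open>[S, D\<^sub>y]\<close> commutes with \<open>D\<^sub>x\<close>, so it also
  kills \<open>\<phi>\<^sub>x\<close> and hence \<open>z\<^sub>y\<close>.
\<close>

section \<open>Derivations of the ring of functions\<close>

locale derivation =
  fixes D :: "'a::comm_ring_1 \<Rightarrow> 'a"
  assumes add: "D (a + b) = D a + D b"
    and mult: "D (a * b) = a * D b + D a * b"
begin

lemma zero [simp]: "D 0 = 0"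
  using add[of 0 0] by simp

lemma one [simp]: "D 1 = 0"
  using mult[of 1 1] by simp

lemma minus: "D (- a) = - D a"
  using add[of a "- a"] by (simp add: eq_neg_iff_add_eq_0 add.commute)

lemma diff: "D (a - b) = D a - D b"
  using add[of a "- b"] by (simp add: minus)

lemma square: "D (a ^ 2) = 2 * a * D a"
  by (simp add: power2_eq_square mult algebra_simps)

lemma of_nat [simp]: "D (of_nat n) = 0"
  by (induction n) (simp_all add: add)

lemma of_int [simp]: "D (of_int k) = 0"
  by (cases k) (simp_all add: minus diff)

lemma sum: "D (sum g I) = (\<Sum>i\<in>I. D (g i))"
  by (induction I rule: infinite_finite_induct) (simp_all add: add)

end

lemma derivation_commutator:
  assumes "derivation D" "derivation E"
  shows "derivation (\<lambda>a. D (E a) - E (D a))"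
proof -
  interpret D: derivation D by fact
  interpret E: derivation E by fact
  show ?thesis
    by unfold_locales (simp_all add: D.add E.add D.mult E.mult algebra_simps)
qed

text \<open>Integers are killed because \<open>D 1 = 0\<close>; multiplying a rational constant by
  its denominator reduces to them, and the denominator is a unit among the functions.\<close>

lemma derivation_cst:
  fixes D :: "fn \<Rightarrow> fn"
  assumes "derivation D"
  shows "D (cst c) = 0"
proof -
  interpret derivation D by fact
  obtain a b where ab: "quotient_of c = (a, b)" by (cases "quotient_of c")
  have b: "b \<noteq> 0" and c: "c = of_int a / of_int b"
    using quotient_of_denom_pos[OF ab] quotient_of_div[OF ab] by auto
  have "of_int b * cst c = of_int a"
    using b by (simp add: cst_def c mult_single flip: single_of_int)
  then have "D (of_int b * cst c) = 0" by simp
  then have "of_int b * D (cst c) = 0" by (simp add: mult)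
  then have "cst (1 / of_int b) * (of_int b * D (cst c)) = 0" by simp
  moreover have "cst (1 / of_int b) * of_int b = 1"
    using b by (simp add: cst_def mult_single flip: single_of_int)
  ultimately show ?thesis by (simp add: mult.assoc[symmetric])
qed

section \<open>Polynomial induction\<close>

lemma update_eq_add_single:
  fixes p :: "'a \<Rightarrow>\<^sub>0 'b::monoid_add"
  assumes "k \<notin> Poly_Mapping.keys p"
  shows "Poly_Mapping.update k c p = p + Poly_Mapping.single k c"
  using assms by (intro poly_mapping_eqI)
    (auto simp: lookup_update lookup_add lookup_single in_keys_iff when_def)

lemma fn_induct [case_names cst var_mult add]:
  fixes p :: fn
  assumes cst: "\<And>c. P (cst c)"
    and var_mult: "\<And>v p. P p \<Longrightarrow> P (var v * p)"
    and add: "\<And>p q. P p \<Longrightarrow> P q \<Longrightarrow> P (p + q)"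
  shows "P p"
proof -
  have monomial: "P (Poly_Mapping.single m c)" for m :: "coord \<Rightarrow>\<^sub>0 nat" and c
  proof (induction m rule: Poly_Mapping.update_induct)
    case const
    then show ?case using cst[of c] by (simp add: cst_def)
  next
    case (update m v k)
    have eq: "Poly_Mapping.update v k m = m + Poly_Mapping.single v k"
      using update(1) by (rule update_eq_add_single)
    have "P (Poly_Mapping.single (m + Poly_Mapping.single v j) c)" for j
    proof (induction j)
      case (Suc j)
      have "Poly_Mapping.single (m + Poly_Mapping.single v (Suc j)) c
          = var v * Poly_Mapping.single (m + Poly_Mapping.single v j) c"
        by (simp add: var_def mult_single single_add[symmetric] add.left_commute)
      with var_mult[OF Suc] show ?case by simp
    qed (use update in simp)
    then show ?case by (simp add: eq)
  qed
  show ?thesis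
  proof (induction p rule: Poly_Mapping.update_induct)
    case const
    then show ?case using cst[of 0] by (simp add: cst_def)
  next
    case (update p m c)
    have "Poly_Mapping.update m c p = p + Poly_Mapping.single m c"
      using update(1) by (rule update_eq_add_single)
    then show ?case using add[OF update(3) monomial] by simp
  qed
qed

text \<open>Additivity and Leibniz spread zero from the coordinates to all polynomials. Applied to
  commutators, this reduces commutation to the coordinates.\<close>

lemma derivation_eq_0I:
  fixes D :: "fn \<Rightarrow> fn"
  assumes "derivation D" "\<And>v. D (var v) = 0"
  shows "D p = 0"
proof -
  interpret derivation D by fact
  show ?thesis
    by (induction p rule: fn_induct) (simp_all add: derivation_cst assms add mult)
qed

section \<open>Partial derivatives and vector fields\<close>

lemma pdiff_conv_sum:
  assumes "finite K" "Poly_Mapping.keys p \<subseteq> K"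
  shows "pdiff v p = (\<Sum>m\<in>K. Poly_Mapping.single (m - Poly_Mapping.single v 1)
      (of_nat (Poly_Mapping.lookup m v) * Poly_Mapping.lookup p m))"
  unfolding pdiff_def using assms
  by (intro sum.mono_neutral_left) (auto simp: in_keys_iff)

lemma pdiff_add: "pdiff v (p + q) = pdiff v p + pdiff v q"
proof -
  let ?K = "Poly_Mapping.keys p \<union> Poly_Mapping.keys q"
  have K: "finite ?K" "Poly_Mapping.keys (p + q) \<subseteq> ?K"
    by (simp_all add: Poly_Mapping.keys_add)
  show ?thesis
    by (simp add: pdiff_conv_sum[OF K] pdiff_conv_sum[of ?K p] pdiff_conv_sum[of ?K q]
        lookup_add distrib_left single_add sum.distrib)
qed

lemma pdiff_single:
  "pdiff v (Poly_Mapping.single m c)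
    = Poly_Mapping.single (m - Poly_Mapping.single v 1) (of_nat (Poly_Mapping.lookup m v) * c)"
  by (simp add: pdiff_def)

lemma pdiff_cst: "pdiff v (cst c) = 0"
  by (simp add: cst_def pdiff_single)

lemma pdiff_var: "pdiff v (var w) = (if v = w then 1 else 0)"
  by (simp add: var_def pdiff_single lookup_single)

lemma pdiff_var_mult: "pdiff v (var w * p) = var w * pdiff v p + pdiff v (var w) * p"
proof (induction p rule: Poly_Mapping.update_induct)
  case const
  then show ?case by (simp add: pdiff_def)
next
  case (update p m c)
  have eq: "Poly_Mapping.update m c p = p + Poly_Mapping.single m c"
    using update(1) by (rule update_eq_add_single)
  let ?e = "\<lambda>v. Poly_Mapping.single v (1::nat)"
  \<comment> \<open>Exponents are subtracted with truncation; wherever that truncates, the factor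
    \<open>Poly_Mapping.lookup m v\<close> is 0.\<close>
  have "pdiff v (var w * Poly_Mapping.single m c)
      = var w * pdiff v (Poly_Mapping.single m c) + pdiff v (var w) * Poly_Mapping.single m c"
  proof (cases "v = w")
    case True
    show ?thesis
    proof (cases "Poly_Mapping.lookup m v = 0")
      case False
      then have "?e v + (m - ?e v) = m"
        by (intro poly_mapping_eqI) (auto simp: lookup_add lookup_minus lookup_single when_def)
      then show ?thesis using True
        by (simp add: pdiff_var pdiff_single var_def mult_single lookup_add single_add distrib_right)
    qed (use True in \<open>simp add: pdiff_var pdiff_single var_def mult_single lookup_add\<close>)
  next
    case False
    show ?thesis
    proof (cases "Poly_Mapping.lookup m v = 0")
      case nz: False
      have "?e w + m - ?e v = ?e w + (m - ?e v)"
        using False nz by (intro poly_mapping_eqI) (auto simp: lookup_add lookup_minus lookup_single when_def)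
      then show ?thesis using False
        by (simp add: pdiff_var pdiff_single var_def mult_single lookup_add lookup_single)
    qed (use False in \<open>simp add: pdiff_var pdiff_single var_def mult_single lookup_add lookup_single\<close>)
  qed
  then show ?case by (simp add: eq pdiff_add update distrib_left distrib_right)
qed

lemma derivation_pdiff: "derivation (pdiff v)"
proof
  show "pdiff v (a + b) = pdiff v a + pdiff v b" for a b by (rule pdiff_add)
  show "pdiff v (a * b) = a * pdiff v b + pdiff v a * b" for a b
  proof (induction a rule: fn_induct)
    case (cst c)
    show ?case
    proof (induction b rule: fn_induct)
      case (cst d)
      then show ?case by (simp add: cst_def mult_single pdiff_single)
    next
      case (var_mult w p)
      then show ?case
        by (simp only: mult.left_commute[of "cst c" "var w"] pdiff_var_mult pdiff_cst)
          (simp add: algebra_simps)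
    next
      case (add p q)
      then show ?case by (simp add: distrib_left pdiff_add pdiff_cst)
    qed
  next
    case (var_mult w p)
    then show ?case
      by (simp only: mult.assoc pdiff_var_mult) (simp add: algebra_simps)
  next
    case (add p q)
    then show ?case by (simp add: pdiff_add algebra_simps)
  qed
qed

lemma finite_vars: "finite (vars p)"
  by (simp add: vars_def)

lemma pdiff_eq_0: "v \<notin> vars p \<Longrightarrow> pdiff v p = 0"
  by (auto simp: pdiff_def vars_def in_keys_iff intro!: sum.neutral)

lemma vf_conv_sum:
  assumes "finite V" "vars p \<subseteq> V"
  shows "vf E p = (\<Sum>v\<in>V. E v * pdiff v p)"
  unfolding vf_def using assms by (intro sum.mono_neutral_left) (auto simp: pdiff_eq_0)

lemma derivation_vf: "derivation (vf E)"
proof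
  interpret pd: derivation "pdiff v" for v by (rule derivation_pdiff)
  fix a b
  let ?V = "vars (a + b) \<union> vars (a * b) \<union> vars a \<union> vars b"
  have V: "vf E p = (\<Sum>v\<in>?V. E v * pdiff v p)" if "vars p \<subseteq> ?V" for p
    using that by (intro vf_conv_sum) (simp_all add: finite_vars)
  show "vf E (a + b) = vf E a + vf E b"
    by (subst (1 2 3) V) (auto simp: pd.add distrib_left sum.distrib)
  have "vf E (a * b) = (\<Sum>v\<in>?V. E v * pdiff v (a * b))" by (rule V) auto
  also have "\<dots> = a * (\<Sum>v\<in>?V. E v * pdiff v b) + (\<Sum>v\<in>?V. E v * pdiff v a) * b"
    unfolding sum_distrib_left sum_distrib_right sum.distrib[symmetric]
    by (intro sum.cong refl) (simp add: pd.mult algebra_simps)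
  also have "(\<Sum>v\<in>?V. E v * pdiff v b) = vf E b" by (rule V[symmetric]) auto
  also have "(\<Sum>v\<in>?V. E v * pdiff v a) = vf E a" by (rule V[symmetric]) auto
  finally show "vf E (a * b) = a * vf E b + vf E a * b" .
qed

lemma vf_var [simp]: "vf E (var v) = E v"
  by (subst vf_conv_sum[of "{v}"]) (simp_all add: vars_def var_def pdiff_def)

section \<open>Laurent series\<close>

text \<open>A lower bound for the order rather than the exact \<open>fls_subdegree\<close>: it
  survives sums with cancellation and covers the zero series.\<close>

definition vanishes_below :: "int \<Rightarrow> 'a::zero fls \<Rightarrow> bool" where
  "vanishes_below a f \<longleftrightarrow> (\<forall>m<a. f $$ m = 0)"

lemma vanishes_belowD: "vanishes_below a f \<Longrightarrow> m < a \<Longrightarrow> f $$ m = 0"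
  by (simp add: vanishes_below_def)

lemma vanishes_below_mono: "vanishes_below a f \<Longrightarrow> b \<le> a \<Longrightarrow> vanishes_below b f"
  by (simp add: vanishes_below_def)

lemma vanishes_below_Suc:
  "vanishes_below a f \<Longrightarrow> f $$ a = 0 \<Longrightarrow> vanishes_below (a + 1) f"
  unfolding vanishes_below_def by (metis zless_add1_eq)

lemma vanishes_below_subdegree: "vanishes_below (fls_subdegree f) f"
  by (simp add: vanishes_below_def)

lemma vanishes_below_le_subdegree: "vanishes_below a f \<Longrightarrow> f \<noteq> 0 \<Longrightarrow> a \<le> fls_subdegree f"
  using fls_subdegree_geI vanishes_belowD by blast

lemma fls_times_nth_bounds:
  fixes f g :: "'a::comm_ring_1 fls"
  assumes "vanishes_below a f" "vanishes_below b g"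
  shows "(f * g) $$ n = (\<Sum>i=a..n - b. f $$ i * g $$ (n - i))"
proof (cases "f = 0 \<or> g = 0")
  case False
  then have "a \<le> fls_subdegree f" "b \<le> fls_subdegree g"
    using assms vanishes_below_le_subdegree by auto
  then show ?thesis
    unfolding fls_times_nth(2)
    by (intro sum.mono_neutral_left) (auto simp: not_le)
qed auto

lemma vanishes_below_mult:
  fixes f g :: "'a::comm_ring_1 fls"
  assumes "vanishes_below a f" "vanishes_below b g"
  shows "vanishes_below (a + b) (f * g)"
  unfolding vanishes_below_def by (auto simp: fls_times_nth_bounds[OF assms])

lemma fls_times_nth_leading:
  fixes f g :: "'a::comm_ring_1 fls"
  assumes "vanishes_below a f" "vanishes_below b g"
  shows "n = a + b \<Longrightarrow> (f * g) $$ n = f $$ a * g $$ b" (is "_ \<Longrightarrow> ?th0")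
    and "n = a + b + 1 \<Longrightarrow> (f * g) $$ n = f $$ a * g $$ (b + 1) + f $$ (a + 1) * g $$ b"
      (is "_ \<Longrightarrow> ?th1")
    and "n = a + b + 2 \<Longrightarrow> (f * g) $$ n
      = f $$ a * g $$ (b + 2) + f $$ (a + 1) * g $$ (b + 1) + f $$ (a + 2) * g $$ b"
      (is "_ \<Longrightarrow> ?th2")
proof -
  show "n = a + b \<Longrightarrow> ?th0" by (simp add: fls_times_nth_bounds[OF assms])
  show ?th1 if n: "n = a + b + 1"
  proof -
    have "{a..n - b} = {a, a + 1}" using n by auto
    then show ?thesis by (simp add: fls_times_nth_bounds[OF assms] n algebra_simps)
  qed
  show ?th2 if n: "n = a + b + 2"
  proof -
    have "{a..n - b} = {a, a + 1, a + 2}" using n by auto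
    then show ?thesis by (simp add: fls_times_nth_bounds[OF assms] n algebra_simps)
  qed
qed

text \<open>The lowest coefficient 1 of \<open>f\<close> carries that of \<open>g\<close> unchanged
  into \<open>f * g\<close>, so nothing can cancel it.\<close>

lemma vanishes_below_cancel:
  fixes f g :: "'a::comm_ring_1 fls"
  assumes f: "vanishes_below a f" "f $$ a = 1" and fg: "vanishes_below (a + b) (f * g)"
  shows "vanishes_below b g"
proof (rule ccontr)
  assume neg: "\<not> vanishes_below b g"
  then have g: "g \<noteq> 0" by (auto simp: vanishes_below_def)
  have "fls_subdegree g < b"
    using neg by (meson linorder_not_less vanishes_below_mono vanishes_below_subdegree)
  then have "(f * g) $$ (a + fls_subdegree g) = 0"
    using fg by (simp add: vanishes_below_def)
  moreover have "(f * g) $$ (a + fls_subdegree g) = g $$ fls_subdegree g"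
    by (simp add: fls_times_nth_leading(1)[OF f(1) vanishes_below_subdegree] f(2))
  ultimately show False using g by simp
qed

lemma fls_leading_1_mult_cancel:
  fixes f g h :: "'a::comm_ring_1 fls"
  assumes "vanishes_below a f" "f $$ a = 1" "f * g = f * h"
  shows "g = h"
proof -
  have "f * (g - h) = 0" using assms(3) by (simp add: algebra_simps)
  then have "vanishes_below b (g - h)" for b
    using vanishes_below_cancel[OF assms(1,2), of b "g - h"] by (simp add: vanishes_below_def)
  then have "(g - h) $$ n = 0" for n
    using vanishes_belowD[of "n + 1" "g - h" n] by simp
  then show ?thesis by (simp add: fls_eq_iff)
qed

lemma fls_leading_1_inverse:
  fixes f :: "'a::comm_ring_1 fls"
  assumes "vanishes_below a f" "f $$ a = 1"
  obtains g where "f * g = 1"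
proof -
  have "fls_subdegree f = a"
    using assms by (intro fls_subdegree_eqI) (auto simp: vanishes_below_def)
  then show ?thesis using that fls_right_inverse[of f 1] assms by auto
qed

section \<open>Coefficientwise action of derivations on Laurent series\<close>

definition coeffwise :: "('a \<Rightarrow> 'a) \<Rightarrow> 'a::zero fls \<Rightarrow> 'a fls" where
  "coeffwise D f = Abs_fls (\<lambda>n. D (f $$ n))"

context derivation
begin

lemma coeffwise_nth [simp]: "coeffwise D f $$ n = D (f $$ n)"
  unfolding coeffwise_def
  by (rule nth_Abs_fls_ex_lower_bound) (metis fls_eq0_below_subdegree zero)

lemma vanishes_below_coeffwise: "vanishes_below a f \<Longrightarrow> vanishes_below a (coeffwise D f)"
  by (simp add: vanishes_below_def)

text \<open>The action preserves lower bounds for the order, so all three Cauchy products run over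
  the same range and Leibniz holds term by term.\<close>

lemma derivation_coeffwise: "derivation (coeffwise D)"
proof
  fix f g
  show "coeffwise D (f + g) = coeffwise D f + coeffwise D g"
    by (rule fls_eqI) (simp add: add)
  define a b where "a = fls_subdegree f" and "b = fls_subdegree g"
  have f: "vanishes_below a f" and g: "vanishes_below b g"
    by (simp_all add: a_def b_def vanishes_below_subdegree)
  show "coeffwise D (f * g) = f * coeffwise D g + coeffwise D f * g"
  proof (rule fls_eqI)
    fix n
    show "coeffwise D (f * g) $$ n = (f * coeffwise D g + coeffwise D f * g) $$ n"
      by (simp add: fls_times_nth_bounds[OF f g]
          fls_times_nth_bounds[OF f vanishes_below_coeffwise[OF g]]
          fls_times_nth_bounds[OF vanishes_below_coeffwise[OF f] g] sum mult sum.distrib)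
  qed
qed

lemma coeffwise_const: "coeffwise D (fls_const c) = fls_const (D c)"
  by (rule fls_eqI) simp

lemma coeffwise_deriv: "coeffwise D (fls_deriv f) = fls_deriv (coeffwise D f)"
  by (rule fls_eqI) (simp add: mult add)

lemma coeffwise_X_intpow_mult:
  "coeffwise D (fls_X_intpow n * f) = fls_X_intpow n * coeffwise D f"
  by (rule fls_eqI) (simp add: fls_X_intpow_times_conv_shift)

end

section \<open>The series \<open>\<phi>\<^sub>x\<close> and \<open>\<phi>\<^sub>y\<close>\<close>

interpretation Dx: derivation Dx
  unfolding Dx_def by (rule derivation_vf)

interpretation Dy: derivation Dy
  unfolding Dy_def by (rule derivation_vf)

interpretation DX: derivation "coeffwise Dx"
  by (rule Dx.derivation_coeffwise)

interpretation DY: derivation "coeffwise Dy"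
  by (rule Dy.derivation_coeffwise)

lemma phiL_nth: "phiL $$ m = (if m = -1 then 1 else if m \<ge> 1 then phiv (nat m) else 0)"
  unfolding phiL_def by (rule nth_Abs_fls_lower_bound[of "-1"]) auto

lemma vanishes_below_phiL: "vanishes_below (- 1) phiL"
  by (simp add: vanishes_below_def phiL_nth)

definition QL :: "fn fls" where
  "QL = phiL ^ 2 - fls_const zx * phiL - fls_const zy"

lemma phiL_square:
  "vanishes_below (- 2) (phiL ^ 2)" "(phiL ^ 2) $$ (- 2) = 1" "(phiL ^ 2) $$ (- 1) = 0"
  "(phiL ^ 2) $$ 0 = - 2 * var Yc"
  using vanishes_below_mult[OF vanishes_below_phiL vanishes_below_phiL]
  by (simp_all add: power2_eq_square phiL_nth phiv_def
      fls_times_nth_leading[OF vanishes_below_phiL vanishes_below_phiL])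

lemma QL_nth:
  "vanishes_below (- 2) QL" "QL $$ (- 2) = 1" "QL $$ (- 1) = - zx"
  "QL $$ 0 = - 2 * var Yc - zy"
  using phiL_square
  by (simp_all add: QL_def vanishes_below_def phiL_nth)

text \<open>Makes the definite descriptions usable: \<open>QL\<close> has lowest coefficient 1, so
  it is a unit and each equation has exactly one solution.\<close>

lemma QL_phixL: "QL * phixL = - 1"
  and QL_phiyL: "QL * phiyL = - (phiL - fls_const zx)"
proof -
  obtain q where q: "QL * q = 1"
    using fls_leading_1_inverse QL_nth by blast
  have "\<exists>!s. QL * s = t" for t
  proof
    show "QL * (q * t) = t" using q by (simp flip: mult.assoc)
    show "s = q * t" if "QL * s = t" for s
      by (rule fls_leading_1_mult_cancel[OF QL_nth(1,2)]) (simp add: that q flip: mult.assoc)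
  qed
  from theI'[OF this] show "QL * phixL = - 1" "QL * phiyL = - (phiL - fls_const zx)"
    by (simp_all only: phixL_def phiyL_def QL_def[symmetric])
qed

lemma phiyL_eq: "phiyL = (phiL - fls_const zx) * phixL"
proof (rule fls_leading_1_mult_cancel[OF QL_nth(1,2)])
  show "QL * phiyL = QL * ((phiL - fls_const zx) * phixL)"
    by (simp add: mult.left_commute[of QL] QL_phixL QL_phiyL)
qed

text \<open>The coefficients of \<open>QL * phixL = - 1\<close> at \<lambda>^0, \<lambda>^1,
  \<lambda>^2 determine these in turn; the last is the first to contain \<open>zy\<close>.\<close>

lemma phixL_nth:
  "vanishes_below 2 phixL" "phixL $$ 2 = - 1" "phixL $$ 3 = - zx"
  "phixL $$ 4 = - (zx ^ 2) - 2 * var Yc - zy"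
proof -
  show v: "vanishes_below 2 phixL"
    by (rule vanishes_below_cancel[OF QL_nth(1,2)]) (simp add: QL_phixL vanishes_below_def)
  show 2: "phixL $$ 2 = - 1"
    using fls_times_nth_leading(1)[OF QL_nth(1) v, of 0] by (simp add: QL_phixL QL_nth)
  have "phixL $$ 3 - zx * phixL $$ 2 = 0"
    using fls_times_nth_leading(2)[OF QL_nth(1) v, of 1] by (simp add: QL_phixL QL_nth)
  then show 3: "phixL $$ 3 = - zx"
    by (simp add: 2 eq_neg_iff_add_eq_0)
  have "phixL $$ 4 - zx * phixL $$ 3 + (- 2 * var Yc - zy) * phixL $$ 2 = 0"
    using fls_times_nth_leading(3)[OF QL_nth(1) v, of 2] by (simp add: QL_phixL QL_nth)
  moreover have "phixL $$ 4 - (- (zx ^ 2) - 2 * var Yc - zy) =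
      phixL $$ 4 - zx * phixL $$ 3 + (- 2 * var Yc - zy) * phixL $$ 2"
    by (simp add: 2 3 algebra_simps power2_eq_square)
  ultimately show "phixL $$ 4 = - (zx ^ 2) - 2 * var Yc - zy"
    by (simp only: right_minus_eq)
qed

lemma phiyL_nth:
  "vanishes_below 1 phiyL" "phiyL $$ 1 = - 1" "phiyL $$ 2 = 0" "phiyL $$ 3 = - zy - var Yc"
proof -
  have v: "vanishes_below (- 1) (phiL - fls_const zx)"
    by (simp add: vanishes_below_def phiL_nth)
  note mult = fls_times_nth_leading[OF v phixL_nth(1)]
  show "vanishes_below 1 phiyL"
    using vanishes_below_mult[OF v phixL_nth(1)] by (simp add: phiyL_eq)
  show "phiyL $$ 1 = - 1" "phiyL $$ 2 = 0" "phiyL $$ 3 = - zy - var Yc"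
    using phixL_nth(2-4)
    by (simp_all add: phiyL_eq mult phiL_nth phiv_def power2_eq_square)
qed

lemma Dx_var: "Dx (var v) = Dx_coef v"
  by (simp add: Dx_def)

lemma Dy_var: "Dy (var v) = Dy_coef v"
  by (simp add: Dy_def)

text \<open>For \<open>k \<ge> 4\<close> this is built into \<open>Dx\<close>; for smaller
  \<open>k\<close> it is a consistency check between the prescribed coefficients of \<phi> and the
  lowest ones of \<open>phixL\<close>.\<close>

lemma Dx_phiv: "Dx (phiv k) = phix k"
proof -
  consider "k = 0" | "k = 1" | "k = 2" | "k = 3" | "k \<ge> 4" by linarith
  then show ?thesis
  proof cases
    case 4
    then show ?thesis
      using phixL_nth(3) by (simp add: phiv_def phix_def Dx.diff Dx.minus Dx.mult Dx.square
        derivation_cst[OF Dx.derivation_axioms] Dx_var Dx_coef_def zx_def)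
  qed (use phixL_nth(1,2) in \<open>simp_all add: phiv_def phix_def vanishes_below_def Dx.minus
    Dx_var Dx_coef_def\<close>)
qed

lemma Dy_phiv: "Dy (phiv k) = phiy k"
proof -
  have half: "cst (1 / 2) * (2 * p) = p" for p
  proof -
    have "cst (1 / 2) * 2 = 1"
      by (simp add: cst_def mult_single flip: single_numeral)
    then show ?thesis by (simp flip: mult.assoc)
  qed
  consider "k = 0" | "k = 1" | "k = 2" | "k = 3" | "k \<ge> 4" by linarith
  then show ?thesis
  proof cases
    case 4
    then show ?thesis
      using phiyL_nth(4) by (simp add: phiv_def phiy_def Dy.diff Dy.minus Dy.mult Dy.square
        derivation_cst[OF Dy.derivation_axioms] Dy_var Dy_coef_def zy_def half)
  qed (use phiyL_nth(1-3) in \<open>simp_all add: phiv_def phiy_def vanishes_below_def Dy.minus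
    Dy_var Dy_coef_def\<close>)
qed

lemma Dx_phiL: "coeffwise Dx phiL = phixL"
  using phixL_nth(1) by (intro fls_eqI) (auto simp: phiL_nth Dx_phiv phix_def vanishes_below_def)

lemma Dy_phiL: "coeffwise Dy phiL = phiyL"
  using phiyL_nth(1) by (intro fls_eqI) (auto simp: phiL_nth Dy_phiv phiy_def vanishes_below_def)

section \<open>Polynomials in \<open>\<phi>\<close>\<close>

text \<open>Closure rules make membership of large expressions automatic;
  \<open>phi_polys_eq_phi_sum\<close> links them to the explicit sums in
  \<open>fPphi\<close>.\<close>

inductive_set phi_polys :: "fn fls set" where
  const: "fls_const c \<in> phi_polys"
| phiL: "phiL \<in> phi_polys"
| add: "F \<in> phi_polys \<Longrightarrow> G \<in> phi_polys \<Longrightarrow> F + G \<in> phi_polys"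
| mult: "F \<in> phi_polys \<Longrightarrow> G \<in> phi_polys \<Longrightarrow> F * G \<in> phi_polys"

lemma phi_polys_0: "0 \<in> phi_polys" and phi_polys_1: "1 \<in> phi_polys"
  using phi_polys.const[of 0] phi_polys.const[of 1] by simp_all

lemma phi_polys_numeral: "numeral k \<in> phi_polys"
  using phi_polys.const[of "numeral k"] by simp

lemma phi_polys_minus: "F \<in> phi_polys \<Longrightarrow> - F \<in> phi_polys"
  using phi_polys.mult[OF phi_polys.const[of "- 1"], of F]
  by (simp only: fls_const_uminus fls_const_1 mult_minus1)

lemma phi_polys_diff: "F \<in> phi_polys \<Longrightarrow> G \<in> phi_polys \<Longrightarrow> F - G \<in> phi_polys"
  using phi_polys.add[OF _ phi_polys_minus, of F G] by simp

lemma phi_polys_power: "F \<in> phi_polys \<Longrightarrow> F ^ k \<in> phi_polys"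
  by (induction k) (simp_all add: phi_polys_1 phi_polys.mult)

lemma phi_polys_sum: "(\<And>i. i \<in> I \<Longrightarrow> g i \<in> phi_polys) \<Longrightarrow> sum g I \<in> phi_polys"
  by (induction I rule: infinite_finite_induct) (simp_all add: phi_polys_0 phi_polys.add)

lemmas phi_polys_intros = phi_polys.intros phi_polys_0 phi_polys_1 phi_polys_numeral
  phi_polys_minus phi_polys_diff phi_polys_power

section \<open>Normal form of polynomials in \<phi>, and the projection\<close>

definition phi_sum :: "(nat \<Rightarrow> fn) \<Rightarrow> nat \<Rightarrow> fn fls" where
  "phi_sum c N = (\<Sum>k\<le>N. fls_const (c k) * phiL ^ k)"

lemma phi_sum_in_phi_polys: "phi_sum c N \<in> phi_polys"
  unfolding phi_sum_def by (intro phi_polys_sum phi_polys_intros)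

lemma phi_sum_pad:
  assumes "N \<le> M"
  shows "phi_sum c N = phi_sum (\<lambda>k. if k \<le> N then c k else 0) M"
  unfolding phi_sum_def using assms by (intro sum.mono_neutral_cong_left) auto

lemma phi_sum_add: "\<exists>d M. phi_sum c N + phi_sum c' N' = phi_sum d M"
proof -
  let ?M = "max N N'" and ?e = "\<lambda>c N k. if k \<le> N then c k else (0 :: fn)"
  have "phi_sum c N + phi_sum c' N' = phi_sum (?e c N) ?M + phi_sum (?e c' N') ?M"
    by (subst (1 2) phi_sum_pad[where M = ?M]) auto
  also have "\<dots> = phi_sum (\<lambda>k. ?e c N k + ?e c' N' k) ?M"
    unfolding phi_sum_def sum.distrib[symmetric]
    by (intro sum.cong refl) (simp only: fls_plus_const[symmetric] distrib_right)
  finally show ?thesis by (intro exI)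
qed

lemma phi_sum_const_mult: "fls_const a * phi_sum c N = phi_sum (\<lambda>k. a * c k) N"
  by (simp only: phi_sum_def sum_distrib_left mult.assoc fls_const_mult_const[symmetric])

lemma phi_sum_phiL_mult:
  "phiL * phi_sum c N = phi_sum (\<lambda>k. if k = 0 then 0 else c (k - 1)) (Suc N)"
  unfolding phi_sum_def sum.atMost_Suc_shift by (simp add: sum_distrib_left mult_ac)

lemma phi_sum_mult: "\<exists>d M. phi_sum c N * phi_sum c' N' = phi_sum d M"
proof -
  have pow: "\<exists>d M. phiL ^ k * phi_sum c N = phi_sum d M" for k
  proof (induction k)
    case (Suc k)
    then obtain d M where "phiL ^ k * phi_sum c N = phi_sum d M" by blast
    then show ?case by (simp add: mult.assoc phi_sum_phiL_mult) blast
  qed auto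
  show ?thesis
  proof (induction N')
    case 0
    have "phi_sum c N * phi_sum c' 0 = fls_const (c' 0) * phi_sum c N"
      by (simp add: phi_sum_def[of c'] mult.commute)
    then show ?case unfolding phi_sum_const_mult by (intro exI)
  next
    case (Suc N')
    have "phi_sum c N * phi_sum c' (Suc N') = phi_sum c N * phi_sum c' N'
        + fls_const (c' (Suc N')) * (phiL ^ Suc N' * phi_sum c N)"
      by (simp add: phi_sum_def[of c'] distrib_left mult_ac)
    moreover obtain d M where "phi_sum c N * phi_sum c' N' = phi_sum d M" using Suc by blast
    moreover obtain e L where "phiL ^ Suc N' * phi_sum c N = phi_sum e L"
      using pow[of "Suc N'"] by blast
    ultimately show ?case using phi_sum_add phi_sum_const_mult by simp
  qed
qed

lemma phi_polys_eq_phi_sum: "F \<in> phi_polys \<Longrightarrow> \<exists>c N. F = phi_sum c N"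
proof (induction rule: phi_polys.induct)
  case (const c)
  have "fls_const c = phi_sum (\<lambda>_. c) 0" by (simp add: phi_sum_def)
  then show ?case by blast
next
  case phiL
  have "phiL = phi_sum (\<lambda>k. if k = 0 then 0 else 1) 1" by (simp add: phi_sum_def)
  then show ?case by blast
qed (metis phi_sum_add, metis phi_sum_mult)

lemma phiL_power_nth:
  "vanishes_below (- int k) (phiL ^ k)" "(phiL ^ k) $$ (- int k) = 1"
proof (induction k)
  case (Suc k)
  {
    case 1
    show ?case using vanishes_below_mult[OF vanishes_below_phiL Suc(1)] by (simp add: algebra_simps)
  next
    case 2
    show ?case using fls_times_nth_leading(1)[OF vanishes_below_phiL Suc(1)] Suc(2)
      by (simp add: phiL_nth)
  }
qed (simp_all add: vanishes_below_def)

text \<open>Since \<phi>^k starts with \<lambda>^(-k), only the top term of degree N reaches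
  \<lambda>^(-N). Its coefficient therefore vanishes, which lowers the degree until only the
  constant is left.\<close>

lemma phi_polys_eq_0:
  assumes "F \<in> phi_polys" "vanishes_below 1 F"
  shows "F = 0"
proof -
  have "phi_sum c N = 0" if "vanishes_below 1 (phi_sum c N)" for c N
    using that
  proof (induction N)
    case 0
    then have "phi_sum c 0 $$ 0 = 0" by (simp add: vanishes_below_def)
    then show ?case by (simp add: phi_sum_def)
  next
    case (Suc N)
    have low: "(fls_const (c k) * phiL ^ k) $$ (- int (Suc N)) = 0" if "k \<le> N" for k
      using that vanishes_belowD[OF phiL_power_nth(1)[of k], of "- int (Suc N)"] by simp
    have "0 = phi_sum c (Suc N) $$ (- int (Suc N))"
      by (rule sym, rule vanishes_belowD[OF Suc.prems]) simp
    also have "\<dots> = (\<Sum>k\<le>N. (fls_const (c k) * phiL ^ k) $$ (- int (Suc N)))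
        + c (Suc N) * (phiL ^ Suc N) $$ (- int (Suc N))"
      unfolding phi_sum_def fls_nth_sum by (simp only: sum.atMost_Suc fls_mult_const_nth)
    also have "\<dots> = c (Suc N)"
      using low phiL_power_nth(2)[of "Suc N"] by (simp only: atMost_iff sum.neutral) simp
    finally have "phi_sum c (Suc N) = phi_sum c N" by (simp add: phi_sum_def)
    then show ?case using Suc by simp
  qed
  then show ?thesis using assms phi_polys_eq_phi_sum by metis
qed

lemma phi_polys_eq_const:
  assumes "F \<in> phi_polys" "vanishes_below 0 F"
  shows "F = fls_const (F $$ 0)"
proof -
  have "F - fls_const (F $$ 0) = 0"
    using assms by (intro phi_polys_eq_0 phi_polys_intros) (auto simp: vanishes_below_def)
  then show ?thesis by simp
qed

lemma ex_phi_poly_part: "\<exists>P\<in>phi_polys. vanishes_below 1 (F - P)"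
proof -
  \<comment> \<open>\<open>m\<close> counts the nonpositive powers that may still occur; each step
    removes the lowest by a multiple of a power of \<phi>.\<close>
  have *: "\<exists>P\<in>phi_polys. vanishes_below 1 (F - P)" if "vanishes_below (1 - int m) F" for m F
    using that
  proof (induction m arbitrary: F)
    case 0
    then show ?case by (auto intro!: bexI[of _ 0] phi_polys_0)
  next
    case (Suc m)
    let ?T = "fls_const (F $$ (- int m)) * phiL ^ m"
    have "vanishes_below (- int m) (F - ?T)"
      using Suc.prems phiL_power_nth(1)[of m] by (auto simp: vanishes_below_def)
    then have "vanishes_below (- int m + 1) (F - ?T)"
      using phiL_power_nth(2)[of m] by (intro vanishes_below_Suc) simp_all
    then obtain P where "P \<in> phi_polys" "vanishes_below 1 (F - ?T - P)"
      using Suc.IH[of "F - ?T"] by (auto simp: add.commute)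
    then show ?case
      by (intro bexI[of _ "?T + P"] phi_polys_intros) (simp_all add: diff_diff_eq)
  qed
  show ?thesis
    by (rule *[of "nat (1 - fls_subdegree F)"], rule vanishes_below_mono[OF vanishes_below_subdegree]) simp
qed

lemma fPphi_eqI:
  assumes "vanishes_below 1 G" "F - G \<in> phi_polys"
  shows "fPphi F = G"
  unfolding fPphi_def
proof (rule the_equality)
  show "(\<forall>m\<le>0. G $$ m = 0) \<and> (\<exists>c N. F - G = (\<Sum>k\<le>N. fls_const (c k) * phiL ^ k))"
    using assms phi_polys_eq_phi_sum[OF assms(2)] by (auto simp: vanishes_below_def phi_sum_def)
next
  fix H assume H: "(\<forall>m\<le>0. H $$ m = 0) \<and> (\<exists>c N. F - H = (\<Sum>k\<le>N. fls_const (c k) * phiL ^ k))"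
  then have "F - H \<in> phi_polys" using phi_sum_in_phi_polys by (auto simp: phi_sum_def)
  with assms(2) have "(F - G) - (F - H) \<in> phi_polys" by (rule phi_polys_diff)
  moreover have "vanishes_below 1 ((F - G) - (F - H))"
    using H assms(1) by (auto simp: vanishes_below_def)
  ultimately have "(F - G) - (F - H) = 0" by (rule phi_polys_eq_0)
  then show "H = G" by simp
qed

lemma fPphi_works: "vanishes_below 1 (fPphi F)" "F - fPphi F \<in> phi_polys"
proof -
  obtain P where P: "P \<in> phi_polys" "vanishes_below 1 (F - P)" using ex_phi_poly_part by blast
  then have "fPphi F = F - P" by (intro fPphi_eqI) auto
  then show "vanishes_below 1 (fPphi F)" "F - fPphi F \<in> phi_polys" using P by auto
qed

text \<open>\<open>P2\<close> is the derivative of \<open>F\<close> as a polynomial in \<open>\<phi>\<close>; it is common to both total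
  derivatives, which is what eliminates it below.\<close>

lemma phi_polys_derivative:
  "F \<in> phi_polys \<Longrightarrow> \<exists>P1\<in>phi_polys. \<exists>P2\<in>phi_polys. \<exists>P3\<in>phi_polys.
     coeffwise Dx F = P1 + P2 * phixL \<and> coeffwise Dy F = P3 + P2 * phiyL"
proof (induction rule: phi_polys.induct)
  case (const c)
  show ?case
    by (intro bexI[of _ "fls_const (Dx c)"] bexI[of _ "fls_const (Dy c)"] bexI[of _ 0])
      (simp_all add: Dx.coeffwise_const Dy.coeffwise_const phi_polys_intros)
next
  case phiL
  show ?case
    by (intro bexI[of _ 0] bexI[of _ 1]) (simp_all add: Dx_phiL Dy_phiL phi_polys_intros)
next
  case (add F G)
  from add.IH(1) obtain P1 P2 P3 where
    "P1 \<in> phi_polys" "P2 \<in> phi_polys" "P3 \<in> phi_polys"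
    "coeffwise Dx F = P1 + P2 * phixL" "coeffwise Dy F = P3 + P2 * phiyL" by blast
  moreover from add.IH(2) obtain R1 R2 R3 where
    "R1 \<in> phi_polys" "R2 \<in> phi_polys" "R3 \<in> phi_polys"
    "coeffwise Dx G = R1 + R2 * phixL" "coeffwise Dy G = R3 + R2 * phiyL" by blast
  ultimately show ?case
    by (intro bexI[of _ "P1 + R1"] bexI[of _ "P2 + R2"] bexI[of _ "P3 + R3"])
      (simp_all add: DX.add DY.add phi_polys.add algebra_simps)
next
  case (mult F G)
  from mult.IH(1) obtain P1 P2 P3 where
    "P1 \<in> phi_polys" "P2 \<in> phi_polys" "P3 \<in> phi_polys"
    "coeffwise Dx F = P1 + P2 * phixL" "coeffwise Dy F = P3 + P2 * phiyL" by blast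
  moreover from mult.IH(2) obtain R1 R2 R3 where
    "R1 \<in> phi_polys" "R2 \<in> phi_polys" "R3 \<in> phi_polys"
    "coeffwise Dx G = R1 + R2 * phixL" "coeffwise Dy G = R3 + R2 * phiyL" by blast
  ultimately show ?case
    by (intro bexI[of _ "F * R1 + P1 * G"] bexI[of _ "F * R2 + P2 * G"] bexI[of _ "F * R3 + P3 * G"])
      (simp_all add: DX.mult DY.mult mult.hyps phi_polys.add phi_polys.mult algebra_simps)
qed

section \<open>Commuting total derivatives\<close>

definition zxL :: "fn fls" where "zxL = fls_const zx"
definition zyL :: "fn fls" where "zyL = fls_const zy"

lemma QL_eq: "QL = phiL ^ 2 - zxL * phiL - zyL"
  by (simp add: QL_def zxL_def zyL_def)

lemma phiyL_eq': "phiyL = (phiL - zxL) * phixL"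
  by (simp add: phiyL_eq zxL_def)

lemma QL_in_phi_polys: "QL \<in> phi_polys" and zxL_in_phi_polys: "zxL \<in> phi_polys"
  unfolding QL_def zxL_def by (intro phi_polys_intros)+

lemma derivation_QL:
  assumes "derivation E"
  shows "E QL = (2 * phiL - zxL) * E phiL - E zxL * phiL - E zyL"
proof -
  interpret derivation E by fact
  show ?thesis unfolding QL_eq diff mult square by (simp add: algebra_simps)
qed

text \<open>Differentiating \<open>QL * phixL = - 1\<close> and multiplying by \<open>phixL\<close>
  eliminates \<open>QL\<close>. The derivation is arbitrary because the formula serves both total
  derivatives, \<open>Ssym\<close> and \<open>fls_deriv\<close>.\<close>

lemma derivation_phixL:
  assumes "derivation E"
  shows "E phixL = phixL ^ 2 * ((2 * phiL - zxL) * E phiL - E zxL * phiL - E zyL)"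
proof -
  interpret derivation E by fact
  have "E (QL * phixL) = 0" by (simp add: QL_phixL minus)
  then have "QL * E phixL + E QL * phixL = 0" by (simp add: mult)
  then have "phixL * (QL * E phixL + E QL * phixL) = 0" by simp
  moreover have "phixL * (QL * E phixL + E QL * phixL)
      = (QL * phixL) * E phixL + phixL ^ 2 * E QL"
    by (simp add: algebra_simps power2_eq_square)
  ultimately show ?thesis by (simp add: QL_phixL derivation_QL[OF assms])
qed

lemma derivation_phiyL:
  assumes "derivation E"
  shows "E phiyL = (E phiL - E zxL) * phixL + (phiL - zxL) * E phixL"
proof -
  interpret derivation E by fact
  show ?thesis unfolding phiyL_eq' diff mult by (simp add: algebra_simps)
qed

lemma Dx_zx: "Dx zx = var (Zc 2 False)" and Dx_zy: "Dx zy = var (Zc 1 True)"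
  and Dy_zx: "Dy zx = var (Zc 1 True)" and Dy_zy: "Dy zy = zyy"
  by (simp_all add: zx_def zy_def Dx_var Dx_coef_def Dy_var Dy_coef_def numeral_2_eq_2)

lemma zyy_eq: "zyy = zy * Dx zx - zx * Dx zy - 1"
  unfolding Dx_zx Dx_zy by (simp add: zyy_def zx_def zy_def)

text \<open>Compatibility of the covering: once z_yy is replaced through the equation, the
  difference of the sides is a multiple of \<open>QL * phixL + 1\<close>.\<close>

lemma DX_phiyL: "coeffwise Dx phiyL = coeffwise Dy phixL"
proof -
  define zxxL zxyL zyyL
    where "zxxL = fls_const (Dx zx)" and "zxyL = fls_const (Dx zy)" and "zyyL = fls_const zyy"
  have X: "coeffwise Dx zxL = zxxL" "coeffwise Dx zyL = zxyL"
    and Y: "coeffwise Dy zxL = zxyL" "coeffwise Dy zyL = zyyL"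
    by (simp_all add: zxL_def zyL_def zxxL_def zxyL_def zyyL_def
        Dx.coeffwise_const Dy.coeffwise_const Dx_zy Dy_zx Dy_zy)
  have zyy: "zyyL = zyL * zxxL - zxL * zxyL - 1"
    by (simp add: zyyL_def zyL_def zxxL_def zxL_def zxyL_def zyy_eq flip: fls_minus_const)
  have Xuy: "coeffwise Dx phiyL = (phixL - zxxL) * phixL
      + (phiL - zxL) * (phixL ^ 2 * ((2 * phiL - zxL) * phixL - zxxL * phiL - zxyL))"
    unfolding derivation_phiyL[OF DX.derivation_axioms] derivation_phixL[OF DX.derivation_axioms]
      X Dx_phiL ..
  have Yux: "coeffwise Dy phixL = phixL ^ 2 * ((2 * phiL - zxL) * phiyL - zxyL * phiL - zyyL)"
    unfolding derivation_phixL[OF DY.derivation_axioms] Y Dy_phiL ..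
  have "coeffwise Dx phiyL - coeffwise Dy phixL = - (zxxL * phixL * (QL * phixL + 1))"
    unfolding Xuy Yux unfolding phiyL_eq' zyy QL_eq
    by (simp add: power2_eq_square algebra_simps)
  then show ?thesis by (simp add: QL_phixL)
qed

lemma Dx_phiy: "Dx (phiy k) = Dy (phix k)"
  using arg_cong[OF DX_phiyL, of "\<lambda>f. f $$ int k"] by (simp add: phix_def phiy_def)

lemma funpow_Dx_commute: "(\<And>p. D (Dx p) = Dx (D p)) \<Longrightarrow> D ((Dx ^^ a) p) = (Dx ^^ a) (D p)"
  by (induction a) simp_all

lemma Dx_Dy_commute: "Dx (Dy p) = Dy (Dx p)"
proof -
  have "derivation (\<lambda>p. Dx (Dy p) - Dy (Dx p))"
    by (rule derivation_commutator[OF Dx.derivation_axioms Dy.derivation_axioms])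
  moreover have "Dx (Dy (var v)) - Dy (Dx (var v)) = 0" for v
    by (auto simp: Dx_var Dy_var Dx_coef_def Dy_coef_def Dx_phiy split: coord.split bool.split)
  ultimately have "Dx (Dy p) - Dy (Dx p) = 0" by (rule derivation_eq_0I)
  then show ?thesis by simp
qed

section \<open>The generating series \<open>f\<close>\<close>

interpretation fls_deriv: derivation "fls_deriv :: fn fls \<Rightarrow> fn fls"
  by unfold_locales simp_all

definition fL :: "int \<Rightarrow> fn fls" where
  "fL n = fPphi (fls_X_intpow n * fls_deriv phiL)"

lemma fco_eq: "fco n i = fL n $$ int i"
  by (simp add: fco_def fL_def)

lemma fL_nth_1_2_3: "fL n $$ 1 = fco n 1" "fL n $$ 2 = fco n 2" "fL n $$ 3 = fco n 3"
  by (simp_all add: fco_eq)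

lemma vanishes_below_fL: "vanishes_below 1 (fL n)"
  unfolding fL_def by (rule fPphi_works)

text \<open>Total derivatives commute with d/d\<lambda> and with the factor \<lambda>^n, and z_x,
  z_y do not depend on \<lambda>. Differentiating \<open>phixL\<close> and \<open>phiyL\<close> in
  \<lambda> thus gives multiples of \<open>F\<close>.\<close>

lemma DX_generator:
  fixes n defines "F \<equiv> fls_X_intpow n * fls_deriv phiL"
  shows "coeffwise Dx F = (2 * phiL - zxL) * phixL ^ 2 * F" (is ?X)
    and "coeffwise Dy F = phixL * F + (phiL - zxL) * (2 * phiL - zxL) * phixL ^ 2 * F" (is ?Y)
proof -
  have const: "fls_deriv zxL = 0" "fls_deriv zyL = 0"
    by (simp_all add: zxL_def zyL_def)
  note ux = derivation_phixL[OF fls_deriv.derivation_axioms, unfolded const]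
    and uy = derivation_phiyL[OF fls_deriv.derivation_axioms, unfolded const]
  show ?X
    unfolding F_def Dx.coeffwise_X_intpow_mult Dx.coeffwise_deriv Dx_phiL ux
    by (simp add: mult_ac)
  show ?Y
    unfolding F_def Dy.coeffwise_X_intpow_mult Dy.coeffwise_deriv Dy_phiL uy ux
    by (simp add: algebra_simps)
qed

section \<open>The series U and V and their closed forms\<close>

lemma zxL_nth: "zxL $$ m = (if m = 0 then zx else 0)"
  by (simp add: zxL_def)

text \<open>\<open>aco n\<close> and \<open>bco n\<close> are the values of
  \<open>S - f2 Dx - f1 Dy\<close> on z_x and z_y, with \<open>f1\<close>, \<open>f2\<close> the
  first two coefficients of f; compare \<open>Dx_Zgen\<close> and \<open>Dy_Zgen\<close>.\<close>

definition aco :: "int \<Rightarrow> fn" where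
  "aco n = (zy + var Yc) * Dx (fco n 1) + zx * Dx (fco n 2) - Dx (fco n 3)"

definition bco :: "int \<Rightarrow> fn" where
  "bco n = fco n 1 + (zy + var Yc) * Dy (fco n 1) + zx * Dy (fco n 2) - Dy (fco n 3)"

definition UL :: "int \<Rightarrow> fn fls" where
  "UL n = coeffwise Dx (fL n) + fls_const (Dx (fco n 2)) * phixL + fls_const (Dx (fco n 1)) * phiyL"

definition VL :: "int \<Rightarrow> fn fls" where
  "VL n = coeffwise Dy (fL n) + fls_const (Dy (fco n 2)) * phixL + fls_const (Dy (fco n 1)) * phiyL"

lemma vanishes_below_3I:
  fixes f :: "'a::zero fls"
  assumes "vanishes_below 1 f" "f $$ 1 = 0" "f $$ 2 = 0"
  shows "vanishes_below 3 f"
  using vanishes_below_Suc[OF vanishes_below_Suc[of 1]] assms by simp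

text \<open>As \<open>phiyL\<close> starts with -\<lambda> and has no \<lambda>^2 term, and
  \<open>phixL\<close> starts with -\<lambda>^2, the two correction terms cancel the coefficients at
  \<lambda> and \<lambda>^2.\<close>

lemma UL_nth: "vanishes_below 3 (UL n)" "UL n $$ 3 = - aco n"
proof -
  note simps = UL_def fL_nth_1_2_3 phixL_nth phiyL_nth
  have ux: "phixL $$ 1 = 0" using phixL_nth(1) by (simp add: vanishes_below_def)
  show "vanishes_below 3 (UL n)"
  proof (rule vanishes_below_3I)
    show "vanishes_below 1 (UL n)"
      using vanishes_below_fL[of n] phixL_nth(1) phiyL_nth(1)
      by (auto simp: vanishes_below_def UL_def)
  qed (simp_all add: simps ux)
  show "UL n $$ 3 = - aco n"
    by (simp add: simps aco_def algebra_simps)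
qed

lemma VL_nth: "vanishes_below 3 (VL n)" "VL n $$ 3 = fco n 1 - bco n"
proof -
  note simps = VL_def fL_nth_1_2_3 phixL_nth phiyL_nth
  have ux: "phixL $$ 1 = 0" using phixL_nth(1) by (simp add: vanishes_below_def)
  show "vanishes_below 3 (VL n)"
  proof (rule vanishes_below_3I)
    show "vanishes_below 1 (VL n)"
      using vanishes_below_fL[of n] phixL_nth(1) phiyL_nth(1)
      by (auto simp: vanishes_below_def VL_def)
  qed (simp_all add: simps ux)
  show "VL n $$ 3 = fco n 1 - bco n"
    by (simp add: simps bco_def algebra_simps)
qed

text \<open>The terms with \<open>F\<close> recombine with f into multiples of the polynomial
  \<open>P\<close>, and \<open>QL * phixL = - 1\<close> absorbs the factors
  \<open>phixL\<close>.\<close>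

lemma UL_VL_phi_polys:
  "QL * VL n - (phiL - zxL) * (QL * UL n) + fL n \<in> phi_polys"
  "QL ^ 2 * UL n - (2 * phiL - zxL) * fL n \<in> phi_polys"
proof -
  define F where "F = fls_X_intpow n * fls_deriv phiL"
  define P where "P = F - fL n"
  have P: "P \<in> phi_polys" unfolding P_def F_def fL_def by (rule fPphi_works)
  then obtain P1 P2 P3 where P123: "P1 \<in> phi_polys" "P2 \<in> phi_polys" "P3 \<in> phi_polys"
    and XP: "coeffwise Dx P = P1 + P2 * phixL" and YP: "coeffwise Dy P = P3 + P2 * phiyL"
    using phi_polys_derivative by blast
  define c1 c2 d1 d2 where "c1 = fls_const (Dx (fco n 1))" and "c2 = fls_const (Dx (fco n 2))"
    and "d1 = fls_const (Dy (fco n 1))" and "d2 = fls_const (Dy (fco n 2))"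
  have cd: "c1 \<in> phi_polys" "c2 \<in> phi_polys" "d1 \<in> phi_polys" "d2 \<in> phi_polys"
    by (simp_all add: c1_def c2_def d1_def d2_def phi_polys.const)
  have f: "fL n = F - P" by (simp add: P_def)
  note gen = DX_generator[of n, folded F_def]
  have U: "UL n = (2 * phiL - zxL) * phixL ^ 2 * F - (P1 + P2 * phixL) + c2 * phixL + c1 * phiyL"
    by (simp add: UL_def f DX.diff gen XP c1_def c2_def)
  have V: "VL n = phixL * F + (phiL - zxL) * (2 * phiL - zxL) * phixL ^ 2 * F
      - (P3 + P2 * phiyL) + d2 * phixL + d1 * phiyL"
    by (simp add: VL_def f DY.diff gen YP d1_def d2_def)
  have Qux2: "QL * phixL ^ 2 = - phixL"
    by (simp add: power2_eq_square QL_phixL flip: mult.assoc)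
  have QU: "QL * UL n = - (2 * phiL - zxL) * phixL * F - QL * P1 + P2 - c2 - c1 * (phiL - zxL)"
  proof -
    have "QL * UL n = (2 * phiL - zxL) * (QL * phixL ^ 2) * F - QL * P1 - P2 * (QL * phixL)
        + c2 * (QL * phixL) + c1 * (phiL - zxL) * (QL * phixL)"
      unfolding U phiyL_eq' by (simp add: algebra_simps)
    then show ?thesis unfolding Qux2 QL_phixL by (simp add: algebra_simps)
  qed
  have QV: "QL * VL n = - F - (phiL - zxL) * (2 * phiL - zxL) * phixL * F
      - QL * P3 + P2 * (phiL - zxL) - d2 - d1 * (phiL - zxL)"
  proof -
    have "QL * VL n = (QL * phixL) * F + (phiL - zxL) * (2 * phiL - zxL) * (QL * phixL ^ 2) * F
        - QL * P3 - P2 * (phiL - zxL) * (QL * phixL)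
        + d2 * (QL * phixL) + d1 * (phiL - zxL) * (QL * phixL)"
      unfolding V phiyL_eq' by (simp add: algebra_simps)
    then show ?thesis unfolding Qux2 QL_phixL by (simp add: algebra_simps)
  qed
  \<comment> \<open>Because \<open>phiyL = (phiL - zxL) * phixL\<close>, both \<open>P2\<close> and
    the terms with \<open>phixL * F\<close> cancel here.\<close>
  have "QL * VL n - (phiL - zxL) * (QL * UL n) + fL n
      = - P - QL * P3 + (phiL - zxL) * (QL * P1) - d2 - d1 * (phiL - zxL)
        + (phiL - zxL) * (c2 + c1 * (phiL - zxL))"
    unfolding QU QV f by (simp add: algebra_simps)
  then show "QL * VL n - (phiL - zxL) * (QL * UL n) + fL n \<in> phi_polys"
    by (simp only:) (intro phi_polys_intros QL_in_phi_polys zxL_in_phi_polys P P123 cd)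
  have "QL ^ 2 * UL n = QL * (QL * UL n)" by (simp add: power2_eq_square mult.assoc)
  also have "\<dots> = - (2 * phiL - zxL) * (QL * phixL) * F
      + QL * (- QL * P1 + P2 - c2 - c1 * (phiL - zxL))"
    unfolding QU by (simp add: algebra_simps)
  also have "\<dots> - (2 * phiL - zxL) * fL n
      = (2 * phiL - zxL) * P + QL * (- QL * P1 + P2 - c2 - c1 * (phiL - zxL))"
    unfolding QL_phixL f by (simp add: algebra_simps)
  finally show "QL ^ 2 * UL n - (2 * phiL - zxL) * fL n \<in> phi_polys"
    by (simp only:) (intro phi_polys_intros QL_in_phi_polys zxL_in_phi_polys P P123 cd)
qed

text \<open>The coefficient of \<open>\<lambda>\<close> in the first relation gives the second claim, which is what makes the
  coefficient of \<open>\<lambda>\<^sup>0\<close> vanish in the proof of \<open>QL_UL\<close>.\<close>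

lemma QL_VL:
  shows "QL * VL n = (phiL - zxL) * (QL * UL n) + fls_const (aco n) - fL n" (is ?eq)
    and "UL n $$ 4 = 2 * fco n 1 - 2 * zx * aco n - bco n" (is ?U4)
proof -
  define W where "W = VL n - (phiL - zxL) * UL n"
  define T where "T = QL * W + fL n"
  have T: "T = QL * VL n - (phiL - zxL) * (QL * UL n) + fL n"
    by (simp add: T_def W_def algebra_simps)
  have v: "vanishes_below (- 1) (phiL - zxL)"
    by (simp add: vanishes_below_def phiL_nth zxL_nth)
  note phiU = fls_times_nth_leading[OF v UL_nth(1)[of n]]
  have W: "vanishes_below 2 W"
    using vanishes_below_mult[OF v UL_nth(1)[of n]] VL_nth(1)[of n]
    by (auto simp: W_def vanishes_below_def)
  have W2: "W $$ 2 = aco n"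
    using VL_nth(1)[of n] by (simp add: W_def phiU UL_nth phiL_nth zxL_nth vanishes_below_def)
  have W3: "W $$ 3 = fco n 1 - bco n - (UL n $$ 4 + zx * aco n)"
    by (simp add: W_def phiU UL_nth VL_nth phiL_nth zxL_nth)
  note QW = fls_times_nth_leading[OF QL_nth(1) W]
  \<comment> \<open>The double pole of \<open>QL\<close> meets the double zero of \<open>W\<close>,
    so the polynomial \<open>T\<close> has no pole and is constant.\<close>
  have "vanishes_below 0 T"
    using vanishes_below_mult[OF QL_nth(1) W] vanishes_below_fL[of n]
    by (auto simp: T_def vanishes_below_def)
  moreover have "T \<in> phi_polys" unfolding T by (rule UL_VL_phi_polys)
  moreover have "T $$ 0 = aco n"
    using vanishes_below_fL[of n] by (simp add: T_def QW W2 QL_nth vanishes_below_def)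
  ultimately have Ta: "T = fls_const (aco n)" using phi_polys_eq_const by metis
  then show ?eq unfolding T by (simp add: algebra_simps)
  have "T $$ 1 = 0" unfolding Ta by simp
  moreover have "T $$ 1 = 2 * fco n 1 - 2 * zx * aco n - bco n - UL n $$ 4"
    by (simp add: T_def QW W2 W3 QL_nth fL_nth_1_2_3 algebra_simps)
  ultimately show ?U4 by simp
qed

text \<open>The difference \<open>R\<close> of the sides is a polynomial in \<phi> with at most a
  simple pole, so two coefficients decide: \<open>UL_nth\<close> settles \<lambda>^(-1), the second
  claim of \<open>QL_VL\<close> settles \<lambda>^0.\<close>

lemma QL_UL:
  "QL ^ 2 * UL n = (2 * phiL - zxL) * fL n - fls_const (aco n) * phiL - fls_const (bco n)"
proof -
  define R where "R = QL ^ 2 * UL n - (2 * phiL - zxL) * fL n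
    + fls_const (aco n) * phiL + fls_const (bco n)"
  have Q2: "vanishes_below (- 4) (QL ^ 2)"
    using vanishes_below_mult[OF QL_nth(1) QL_nth(1)] by (simp add: power2_eq_square)
  have Q2_nth: "(QL ^ 2) $$ (- 4) = 1" "(QL ^ 2) $$ (- 3) = - 2 * zx"
    using QL_nth by (simp_all add: power2_eq_square fls_times_nth_leading[OF QL_nth(1) QL_nth(1)])
  have v: "vanishes_below (- 1) (2 * phiL - zxL)"
    by (simp add: vanishes_below_def phiL_nth zxL_nth)
  note QU = fls_times_nth_leading[OF Q2 UL_nth(1)[of n]]
    and phif = fls_times_nth_leading[OF v vanishes_below_fL[of n]]
  have low: "vanishes_below (- 1) (QL ^ 2 * UL n)" "vanishes_below 0 ((2 * phiL - zxL) * fL n)"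
    using vanishes_below_mult[OF Q2 UL_nth(1)[of n]] vanishes_below_mult[OF v vanishes_below_fL[of n]]
    by simp_all
  have "vanishes_below (- 1) R"
    using low by (auto simp: R_def vanishes_below_def phiL_nth)
  moreover have "R $$ (- 1) = 0"
    using low(2) by (simp add: R_def QU Q2_nth UL_nth phiL_nth vanishes_below_def)
  moreover have "R $$ 0 = 0"
    unfolding R_def
    by (simp add: QU phif Q2_nth UL_nth phiL_nth zxL_nth QL_VL fL_nth_1_2_3)
  ultimately have "vanishes_below 1 R"
    using vanishes_below_Suc[OF vanishes_below_Suc[of "- 1" R]] by simp
  moreover have "R \<in> phi_polys"
    unfolding R_def by (intro phi_polys.add phi_polys.mult UL_VL_phi_polys phi_polys.const phi_polys.phiL)
  ultimately have "R = 0" by (intro phi_polys_eq_0)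
  moreover have "QL ^ 2 * UL n - ((2 * phiL - zxL) * fL n - fls_const (aco n) * phiL
      - fls_const (bco n)) = R"
    by (simp add: R_def)
  ultimately show ?thesis by (simp only: right_minus_eq)
qed

text \<open>This and \<open>VL_eq\<close> have the shape of \<open>derivation_phixL\<close> and
  \<open>derivation_phiyL\<close> for a derivation sending \<phi>, z_x, z_y to \<open>fL n\<close>,
  \<open>aco n\<close>, \<open>bco n\<close>.\<close>

lemma UL_eq: "UL n = phixL ^ 2 * ((2 * phiL - zxL) * fL n - fls_const (aco n) * phiL - fls_const (bco n))"
proof -
  have "UL n = (QL * phixL) ^ 2 * UL n" by (simp add: QL_phixL)
  also have "\<dots> = phixL ^ 2 * (QL ^ 2 * UL n)" by (simp add: power_mult_distrib mult_ac)
  finally show ?thesis unfolding QL_UL .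
qed

lemma VL_eq: "VL n = (fL n - fls_const (aco n)) * phixL + (phiL - zxL) * UL n"
proof -
  have "VL n = - ((QL * phixL) * VL n)" by (simp add: QL_phixL)
  also have "\<dots> = - (phixL * (QL * VL n))" by (simp add: mult_ac)
  also have "\<dots> = (fL n - fls_const (aco n)) * phixL - (phiL - zxL) * ((QL * phixL) * UL n)"
    unfolding QL_VL by (simp add: algebra_simps)
  finally show ?thesis by (simp add: QL_phixL)
qed

section \<open>The symmetry\<close>

context
  fixes n :: int
begin

interpretation S: derivation "Ssym n"
  unfolding Ssym_def by (rule derivation_vf)

interpretation SL: derivation "coeffwise (Ssym n)"
  by (rule S.derivation_coeffwise)

lemma Ssym_var: "Ssym n (var v) = S_coef n v"
  by (simp add: Ssym_def)

lemma Ssym_z: "Ssym n (var (Zc 0 False)) = Zgen n"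
  and Ssym_zx: "Ssym n zx = Dx (Zgen n)" and Ssym_zy: "Ssym n zy = Dy (Zgen n)"
  by (simp_all add: zx_def zy_def Ssym_var S_coef_def)

lemma phix_1_2_3: "phix 1 = 0" "phix 2 = - 1" "phix 3 = - zx"
  and phiy_1_2_3: "phiy 1 = - 1" "phiy 2 = 0" "phiy 3 = - zy - var Yc"
  using phixL_nth phiyL_nth by (simp_all add: phix_def phiy_def vanishes_below_def)

text \<open>For \<open>k < 4\<close> this is where the definition of \<open>Z\<close> and the vanishing of \<open>S\<close> on \<open>x\<close> and \<open>y\<close>
  come in.\<close>

lemma Ssym_phiv: "k \<ge> 1 \<Longrightarrow> Ssym n (phiv k) = Phigen n k"
proof -
  assume "k \<ge> 1"
  then consider "k = 1" | "k = 2" | "k = 3" | "k \<ge> 4" by linarith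
  then show ?thesis
  proof cases
    case 3
    then show ?thesis
      by (simp add: phiv_def Phigen_def Zgen_def phix_1_2_3 phiy_1_2_3 S.diff S.minus S.mult
          S.square derivation_cst[OF S.derivation_axioms] Ssym_z)
        (simp add: Ssym_var S_coef_def algebra_simps)
  qed (simp_all add: phiv_def Phigen_def phix_1_2_3 phiy_1_2_3 S.minus Ssym_var S_coef_def
      flip: One_nat_def)
qed

lemma Ssym_phiL:
  "coeffwise (Ssym n) phiL = fL n + fls_const (fco n 2) * phixL + fls_const (fco n 1) * phiyL"
  using vanishes_below_fL[of n] phixL_nth(1) phiyL_nth(1)
  by (intro fls_eqI)
    (auto simp: phiL_nth Ssym_phiv Phigen_def fco_eq phix_def phiy_def vanishes_below_def)

lemma Dx_Zgen: "Dx (Zgen n) = aco n + fco n 2 * Dx zx + fco n 1 * Dx zy"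
proof -
  have "Dx (var Yc) = 0" by (simp add: Dx_var Dx_coef_def)
  then show ?thesis
    unfolding Zgen_def aco_def by (simp add: Dx.add Dx.diff Dx.mult algebra_simps)
qed

lemma Dy_Zgen: "Dy (Zgen n) = bco n + fco n 2 * Dx zy + fco n 1 * zyy"
proof -
  have "Dy (var Yc) = 1" "Dy zx = Dx zy" by (simp_all add: Dy_var Dy_coef_def Dx_zy Dy_zx)
  then show ?thesis
    unfolding Zgen_def bco_def by (simp add: Dy.add Dy.diff Dy.mult Dy_zy algebra_simps)
qed

text \<open>\<open>UL\<close> and \<open>VL\<close> are the images of \<open>\<phi>\<^sub>x\<close> and \<open>\<phi>\<^sub>y\<close> under
  \<open>S - f\<^sup>(\<^sup>2\<^sup>) D\<^sub>x - f\<^sup>(\<^sup>1\<^sup>) D\<^sub>y\<close>.\<close>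

lemma Ssym_phixL: "coeffwise (Ssym n) phixL = coeffwise Dx (coeffwise (Ssym n) phiL)"
  and Ssym_phiyL: "coeffwise (Ssym n) phiyL = coeffwise Dy (coeffwise (Ssym n) phiL)"
proof -
  define zxxL zxyL zyyL
    where "zxxL = fls_const (Dx zx)" and "zxyL = fls_const (Dx zy)" and "zyyL = fls_const zyy"
  have X: "coeffwise Dx zxL = zxxL" "coeffwise Dx zyL = zxyL"
    and Y: "coeffwise Dy zxL = zxyL" "coeffwise Dy zyL = zyyL"
    by (simp_all add: zxL_def zyL_def zxxL_def zxyL_def zyyL_def
        Dx.coeffwise_const Dy.coeffwise_const Dx_zy Dy_zx Dy_zy)
  define f1 f2 A B where "f1 = fls_const (fco n 1)" and "f2 = fls_const (fco n 2)"
    and "A = fls_const (aco n)" and "B = fls_const (bco n)"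
  have S: "coeffwise (Ssym n) zxL = A + f2 * zxxL + f1 * zxyL"
    "coeffwise (Ssym n) zyL = B + f2 * zxyL + f1 * zyyL"
    by (simp_all add: zxL_def zyL_def S.coeffwise_const Ssym_zx Ssym_zy Dx_Zgen Dy_Zgen
        A_def B_def f1_def f2_def zxxL_def zxyL_def zyyL_def flip: fls_plus_const)
  note Sphi = Ssym_phiL[folded f1_def f2_def]
  note U = UL_eq[of n, folded A_def B_def] and V = VL_eq[of n, folded A_def]
  have Xux: "coeffwise Dx phixL = phixL ^ 2 * ((2 * phiL - zxL) * phixL - zxxL * phiL - zxyL)"
    unfolding derivation_phixL[OF DX.derivation_axioms] X Dx_phiL ..
  have Yux: "coeffwise Dy phixL = phixL ^ 2 * ((2 * phiL - zxL) * phiyL - zxyL * phiL - zyyL)"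
    unfolding derivation_phixL[OF DY.derivation_axioms] Y Dy_phiL ..
  \<comment> \<open>Rewritten as the x-derivative of \<open>phiyL\<close>, this matches the factor
    of \<open>f2\<close> in the image of \<open>phiyL\<close> under S.\<close>
  have Yux': "coeffwise Dy phixL = (phixL - zxxL) * phixL + (phiL - zxL) * coeffwise Dx phixL"
    unfolding DX_phiyL[symmetric] derivation_phiyL[OF DX.derivation_axioms] X Dx_phiL ..
  have Yuy: "coeffwise Dy phiyL = (phiyL - zxyL) * phixL + (phiL - zxL) * coeffwise Dy phixL"
    unfolding derivation_phiyL[OF DY.derivation_axioms] Y Dy_phiL ..
  have XS: "coeffwise Dx (coeffwise (Ssym n) phiL)
      = UL n + f2 * coeffwise Dx phixL + f1 * coeffwise Dy phixL"
    unfolding Sphi DX.add DX.mult DX_phiyL f1_def f2_def Dx.coeffwise_const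
    by (simp add: UL_def)
  have YS: "coeffwise Dy (coeffwise (Ssym n) phiL)
      = VL n + f2 * coeffwise Dy phixL + f1 * coeffwise Dy phiyL"
    unfolding Sphi DY.add DY.mult f1_def f2_def Dy.coeffwise_const
    by (simp add: VL_def)
  \<comment> \<open>\<open>derivation_phixL\<close> is linear in the values on \<phi>, z_x, z_y,
    which split into the data of \<open>UL_eq\<close>, \<open>f2\<close> times those of
    \<open>Dx\<close> and \<open>f1\<close> times those of \<open>Dy\<close>.\<close>
  have Sux: "coeffwise (Ssym n) phixL = UL n + f2 * coeffwise Dx phixL + f1 * coeffwise Dy phixL"
    unfolding derivation_phixL[OF SL.derivation_axioms] Sphi S U Xux Yux
    by (simp add: algebra_simps)
  then show "coeffwise (Ssym n) phixL = coeffwise Dx (coeffwise (Ssym n) phiL)"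
    unfolding XS .
  have "coeffwise (Ssym n) phiyL = (coeffwise (Ssym n) phiL - coeffwise (Ssym n) zxL) * phixL
      + (phiL - zxL) * coeffwise (Ssym n) phixL"
    by (rule derivation_phiyL[OF SL.derivation_axioms])
  also have "\<dots> = VL n + f2 * ((phixL - zxxL) * phixL + (phiL - zxL) * coeffwise Dx phixL)
      + f1 * ((phiyL - zxyL) * phixL + (phiL - zxL) * coeffwise Dy phixL)"
    unfolding Sux Sphi S V by (simp add: algebra_simps)
  also have "\<dots> = coeffwise Dy (coeffwise (Ssym n) phiL)"
    unfolding YS Yuy Yux'[symmetric] ..
  finally show "coeffwise (Ssym n) phiyL = coeffwise Dy (coeffwise (Ssym n) phiL)" .
qed

lemma Ssym_phix: "k \<ge> 1 \<Longrightarrow> Ssym n (phix k) = Dx (Phigen n k)"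
  and Ssym_phiy: "k \<ge> 1 \<Longrightarrow> Ssym n (phiy k) = Dy (Phigen n k)"
  using arg_cong[OF Ssym_phixL, of "\<lambda>f. f $$ int k"] arg_cong[OF Ssym_phiyL, of "\<lambda>f. f $$ int k"]
  by (simp_all add: phix_def phiy_def phiL_nth Ssym_phiv)

text \<open>On the z-coordinates the components of S are prolonged by \<open>Dx\<close>; on the
  nonlocal ones \<open>Ssym_phix\<close> applies.\<close>

lemma Ssym_Dx_commute: "Ssym n (Dx p) = Dx (Ssym n p)"
proof -
  have "derivation (\<lambda>p. Ssym n (Dx p) - Dx (Ssym n p))"
    by (rule derivation_commutator[OF S.derivation_axioms Dx.derivation_axioms])
  moreover have "Ssym n (Dx (var v)) - Dx (Ssym n (var v)) = 0" for v
    by (cases v) (simp_all add: Dx_var Ssym_var Dx_coef_def S_coef_def Ssym_phix)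
  ultimately have "Ssym n (Dx p) - Dx (Ssym n p) = 0" by (rule derivation_eq_0I)
  then show ?thesis by simp
qed

text \<open>The commutator \<open>W\<close> of \<open>S\<close> and \<open>D\<^sub>y\<close> commutes with \<open>D\<^sub>x\<close> by the Jacobi identity and
  kills every \<open>\<phi>\<^sup>(\<^sup>k\<^sup>)\<close>, hence also \<open>\<phi>\<^sup>(\<^sup>4\<^sup>)\<^sub>x\<close>, which involves \<open>z\<^sub>y\<close>.  So the linearised
  equation \<open>S(z\<^sub>y\<^sub>y) = D\<^sub>y\<^sup>2 Z\<close> needs no separate computation.\<close>

lemma Ssym_Dy_commute: "Ssym n (Dy p) = Dy (Ssym n p)"
proof -
  define W where "W p = Ssym n (Dy p) - Dy (Ssym n p)" for p
  have W: "derivation W"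
    unfolding W_def by (rule derivation_commutator[OF S.derivation_axioms Dy.derivation_axioms])
  interpret W: derivation W by (fact W)
  have W_Dx: "W (Dx p) = Dx (W p)" for p
    by (simp add: W_def Dx.diff Ssym_Dx_commute Dx_Dy_commute flip: Dx_Dy_commute)
  have W_phi: "W (phiv k) = 0" if "k \<ge> 1" for k
    using that by (simp add: W_def Dy_phiv Ssym_phiv Ssym_phiy)
  have W_x: "W (var Xc) = 0" and W_y: "W (var Yc) = 0"
    by (simp_all add: W_def Dy_var Ssym_var Dy_coef_def S_coef_def)
  have W_z: "W (var (Zc 0 False)) = 0"
    by (simp add: W_def Dy_var Ssym_var Dy_coef_def S_coef_def)
  have Zc_funpow: "(Dx ^^ a) (var (Zc 0 b)) = var (Zc a b)" for a b
    by (induction a) (simp_all add: Dx_var Dx_coef_def)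
  have W_zx: "W zx = 0"
    using W_Dx[of "var (Zc 0 False)"] W_z by (simp add: zx_def Dx_var Dx_coef_def)
  have "W (phix 4) = 0"
    using W_Dx[of "phiv 4"] W_phi[of 4] by (simp add: Dx_phiv)
  moreover have "phix 4 = - (zx ^ 2) - 2 * var Yc - zy"
    using phixL_nth(4) by (simp add: phix_def)
  moreover have "W (2 * var Yc) = 0"
    by (simp only: mult_2 W.add W_y add_0)
  ultimately have W_zy: "W zy = 0"
    by (simp add: W.diff W.minus W.square W_zx)
  have Dx_0: "(Dx ^^ a) 0 = 0" for a by (induction a) simp_all
  have "W (var v) = 0" for v
  proof (cases v)
    \<comment> \<open>Each z-coordinate is an iterated x-derivative of z or z_y, and
      \<open>W\<close> commutes with \<open>Dx\<close>.\<close>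
    case (Zc a b)
    then show ?thesis using W_z W_zy
      by (cases b) (simp_all add: funpow_Dx_commute[of W, OF W_Dx] zy_def Dx_0
        flip: Zc_funpow[of a])
  next
    case (Phi j)
    then show ?thesis using W_phi[of "j + 4"] by (simp add: phiv_def)
  qed (simp_all add: W_x W_y)
  then have "W p = 0" by (rule derivation_eq_0I[OF W])
  then show ?thesis by (simp add: W_def)
qed

end

theorem mainTheorem2:
  fixes n :: int
  shows "(\<forall>p. Ssym n (Dx p) = Dx (Ssym n p)) \<and> (\<forall>p. Ssym n (Dy p) = Dy (Ssym n p))"
  using Ssym_Dx_commute Ssym_Dy_commute by blast

end
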